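(* Let $A\in\mathbb{R}^{12\times 12}$, $B\in\mathbb{R}^{12\times 4}$, let $Q\in\mathbb{R}^{12\times12}$ be symmetric positive semi-definite and $R\in\mathbb{R}^{4\times4}$ symmetric positive definite, with $(A,B)$ stabilizable and $(A,\sqrt{Q})$ detectable. Let $K_{EP}=R^{-1}B^{\top}S$ be the corresponding optimal (LQR) feedback matrix, and let $X(\cdot)$, $U(\cdot)$ be optimal state and control trajectories, so that $\dot X=AX+BU$ and $U(t)=-K_{EP}X(t)$ for all $t\ge 0$. Let $\Sigma(t)$, $\Sigma_u(t)$ be the history stack built from $(X,U)$ at the recorded time instances $t_1(t),\dots,t_N(t)$, let $\mathcal{X}(t)$, $\mathcal{Z}(t)$ be the associated data matrices, and let $\hat W(\cdot)$ be a solution of the update law $$\dot{\hat W}=(\Sigma^{\top}\Sigma+\epsilon I)^{-1}\Sigma^{\top}\left(\Sigma_u-\Sigma\hat W\right),$$ with $\hat Q(t),\hat S(t),\hat R(t)$ the symmetric matrices extracted from $\hat W(t)$ (all as defined in the context). Suppose that there exists $\underline{T}\ge 0$ such that: (i) $\Sigma_u(t)\in\operatorname{Range}(\Sigma(t))$ for all $t\ge\underline{T}$; (ii) $\epsilon\ge 0$ is such that $\Sigma^{\top}(t)\Sigma(t)+\epsilon I$ is invertible for all $t\ge\underline{T}$; (iii) there is a constant $\epsilon_0>0$ such that $\min\{\operatorname{eig}(\mathcal{X}(t)\mathcal{X}(t)^{\top})\}>\epsilon_0$ and $\min\{\operatorname{eig}(\mathcal{Z}(t)\mathcal{Z}(t)^{\top})\}>\epsilon_0$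 for all $t\ge\underline{T}$; (iv) there is a constant $0\le\underline{R}<\infty$ such that $\hat R(t)$ is invertible with $\|\hat R^{-1}(t)\|\le\underline{R}$ for all $t\ge\underline{T}$. Then, as $t\to\infty$, the matrices $\hat Q(t)$, $\hat S(t)$, $\hat R(t)$ converge to a $0$-equivalent solution of the inverse reinforcement learning (IRL) problem (the case $\varpi=0$ of the notion of $\varpi$-equivalent solution defined in the context).
   Context: **Optimal control problem.** The system is $\dot X=AX+BU$ with $X\in\mathbb{R}^{12}$, $U\in\mathbb{R}^4$, and the cost is $J(X_0,U(\cdot))=\int_0^\infty (X^{\top}QX+U^{\top}RU)\,dt$. $S$ is the symmetric positive semi-definite stabilizing solution of $A^{\top}S+SA-SBR^{-1}B^{\top}S+Q=0$; the optimal control is $U=-K_{EP}X$ with $K_{EP}=R^{-1}B^{\top}S$. The IRL problem is to find, from $X$, $U$, $A$, $B$ (with $Q,R$ unknown), a triple $(\hat Q,\hat S,\hat R)$ reproducing the feedback $K_{EP}$. **Equivalent solution.** For $\varpi\ge 0$, a triple $(\hat Q,\hat S,\hat R)$ of symmetric matrices with $\hat R$ invertible is called a $\varpi$-equivalent solution of the IRL problem if $$\|A^{\top}\hat S+\hat SA-\hat SB\hat R^{-1}B^{\top}\hat S+\hat Q\|\le\varpi$$ and the feedback matrix $\hat K_p:=\hat R^{-1}B^{\top}\hat S$ obtained from optimizing $J$ with $Q=\hat Q$, $R=\hat R$ satisfies $\|\hat K_p-K_{EP}\|\le\varpi$. **Basis functions and weights.** Define $\sigma_S(X)=\sigma_Q(X)\in\mathbb{R}^{78}$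 as the vector listing, for $1\le i\le j\le 12$ in lexicographic order, $X_i^2$ if $i=j$ and $2X_iX_j$ if $i<j$. Define $\sigma_{R1}(U)\in\mathbb{R}^{10}$ in the same way for $U\in\mathbb{R}^4$. For symmetric $\hat S,\hat Q\in\mathbb{R}^{12\times12}$ and $\hat R\in\mathbb{R}^{4\times 4}$, the weights $\hat W_S\in\mathbb{R}^{78}$, $\hat W_Q\in\mathbb{R}^{78}$, $\hat W_R\in\mathbb{R}^{10}$ are the vectors of upper-triangular entries (same order), so that $\hat W_S^{\top}\sigma_S(X)=X^{\top}\hat SX$, $\hat W_Q^{\top}\sigma_Q(X)=X^{\top}\hat QX$, $\hat W_R^{\top}\sigma_{R1}(U)=U^{\top}\hat RU$. The matrix $\sigma_{R2}(U)\in\mathbb{R}^{4\times10}$ is the matrix, linear in $U$, with $\sigma_{R2}(U)\hat W_R=\hat RU$ for every symmetric $\hat R$. The $(1,1)$ entry of $\hat R$, denoted $r_1$ (the first element of $\hat W_R$), is fixed to $r_1=1$. $\hat W_R^-\in\mathbb{R}^9$ is $\hat W_R$ with its first element removed, $\sigma_{R1}^-$ is $\sigma_{R1}$ with its first element removed, and $\sigma_{R2}^-$ is $\sigma_{R2}$ with its first column removed. The estimated vector is $\hat W=[\hat W_S^{\top},\hat W_Q^{\top},(\hat W_R^-)^{\top}]^{\top}\in\mathbb{R}^{165}$; "extracting" $\hat Q,\hat S,\hat R$ from $\hat W$ means recovering the symmetric matrices from these weights, with $\hat R_{11}=r_1=1$. **History stack.** With $\nabla_X\sigma_S(X)\in\mathbb{R}^{78\times12}$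 the Jacobian, let $$\sigma_\delta(X,U)=\begin{bmatrix}(AX+BU)^{\top}(\nabla_X\sigma_S(X))^{\top} & \sigma_Q(X)^{\top} & \sigma_{R1}^-(U)^{\top}\end{bmatrix}\in\mathbb{R}^{1\times165},$$ $$\sigma_{\Delta_u}(X,U)=\begin{bmatrix}B^{\top}(\nabla_X\sigma_S(X))^{\top} & 0_{4\times78} & 2\sigma_{R2}^-(U)\end{bmatrix}\in\mathbb{R}^{4\times165}.$$ For $N$ recorded time instances $t_1,\dots,t_N$, $\Sigma\in\mathbb{R}^{5N\times165}$ is obtained by stacking vertically, for $i=1,\dots,N$, the blocks $\sigma_\delta(X(t_i),U(t_i))$ and $\sigma_{\Delta_u}(X(t_i),U(t_i))$. Likewise $\Sigma_u\in\mathbb{R}^{5N}$ is obtained by stacking, for $i=1,\dots,N$, the entries $-U_1^2(t_i)r_1$, $-2U_1(t_i)r_1$, $0_{3\times1}$. The stack is initialized with zeros (an unfilled slot contributes zero data), and recorded data are added or replaced only at instants of a fixed sampling interval. Any data selection algorithm ensuring the hypotheses may be used; the one used in the paper replaces old data with new data only if this lowers the condition number of $\Sigma^{\top}\Sigma+\epsilon I$. Hence $t_i=t_i(t)\le t$ are piecewise constant functions of time, and so are $\Sigma(t)$, $\Sigma_u(t)$. **Data matrices.** $\mathcal{X}(t)=[X(t_1(t)),\dots,X(t_N(t))]\in\mathbb{R}^{12\times N}$ and $\mathcal{Z}(t)=[\operatorname{uvec}(X(t_1(t))X(t_1(t))^{\top}),\dots,\operatorname{uvec}(X(t_N(t))X(t_N(t))^{\top})]\in\mathbb{R}^{78\times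 N}$, where $\operatorname{uvec}(M)\in\mathbb{R}^{78}$ is the vector of upper-triangular entries (including the diagonal) of a symmetric $12\times12$ matrix $M$. $\operatorname{eig}(\cdot)$ denotes the set of eigenvalues. *)

theory Defs
  imports "HOL-Analysis.Analysis"
begin

section \<open>Matrices and linear control theory\<close>

definition symmetric_mat :: "real^'n^'n \<Rightarrow> bool" where
  "symmetric_mat M \<longleftrightarrow> transpose M = M"

definition pos_semidef :: "real^'n^'n \<Rightarrow> bool" where
  "pos_semidef M \<longleftrightarrow> symmetric_mat M \<and> (\<forall>v. 0 \<le> v \<bullet> (M *v v))"

definition pos_def :: "real^'n^'n \<Rightarrow> bool" where
  "pos_def M \<longleftrightarrow> symmetric_mat M \<and> (\<forall>v. v \<noteq> 0 \<longrightarrow> 0 < v \<bullet> (M *v v))"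

definition sqrt_mat :: "real^'n^'n \<Rightarrow> real^'n^'n" where
  "sqrt_mat M = (THE P. pos_semidef P \<and> P ** P = M)"

definition eig :: "'a::field^'n^'n \<Rightarrow> 'a set" where
  "eig M = {l. \<exists>v. v \<noteq> 0 \<and> M *v v = l *s v}"

definition hurwitz :: "real^'n^'n \<Rightarrow> bool" where
  "hurwitz M \<longleftrightarrow> (\<forall>l\<in>eig (map_matrix complex_of_real M). Re l < 0)"

definition stabilizable :: "real^'n^'n \<Rightarrow> real^'m^'n \<Rightarrow> bool" where
  "stabilizable A B \<longleftrightarrow> (\<exists>F. hurwitz (A + B ** F))"

definition detectable :: "real^'n^'n \<Rightarrow> real^'n^'p \<Rightarrow> bool" where
  "detectable A C \<longleftrightarrow> (\<exists>L. hurwitz (A + L ** C))"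

definition care_residual ::
  "real^'n^'n \<Rightarrow> real^'m^'n \<Rightarrow> real^'n^'n \<Rightarrow> real^'n^'n \<Rightarrow> real^'m^'m \<Rightarrow> real^'n^'n" where
  "care_residual A B Q S R =
     transpose A ** S + S ** A - S ** B ** matrix_inv R ** transpose B ** S + Q"

definition feedback :: "real^'m^'n \<Rightarrow> real^'n^'n \<Rightarrow> real^'m^'m \<Rightarrow> real^'n^'m" where
  "feedback B S R = matrix_inv R ** transpose B ** S"

definition stabilizing_solution ::
  "real^'n^'n \<Rightarrow> real^'m^'n \<Rightarrow> real^'n^'n \<Rightarrow> real^'m^'m \<Rightarrow> real^'n^'n \<Rightarrow> bool" where
  "stabilizing_solution A B Q R S \<longleftrightarrow>
     pos_semidef S \<and> care_residual A B Q S R = 0 \<and> hurwitz (A - B ** feedback B S R)"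

definition equivalent_solution ::
  "real \<Rightarrow> real^'n^'n \<Rightarrow> real^'m^'n \<Rightarrow> real^'n^'m \<Rightarrow>
     real^'n^'n \<Rightarrow> real^'n^'n \<Rightarrow> real^'m^'m \<Rightarrow> bool" where
  "equivalent_solution w A B K Q S R \<longleftrightarrow>
     symmetric_mat Q \<and> symmetric_mat S \<and> symmetric_mat R \<and> invertible R \<and>
     norm (care_residual A B Q S R) \<le> w \<and> norm (feedback B S R - K) \<le> w"


section \<open>Basis functions and weights\<close>

typedef (overloaded) ('n::linorder) utri = "{p :: 'n \<times> 'n. fst p \<le> snd p}"
  by auto

instance utri :: ("{finite,linorder}") finite
proof
  have "inj (Rep_utri :: 'a utri \<Rightarrow> 'a \<times> 'a)"
    by (meson injI Rep_utri_inject)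
  then show "finite (UNIV :: 'a utri set)"
    by (rule finite_imageD[rotated]) (rule finite_class.finite)
qed

text \<open>
  Vectors of upper-triangular entries are indexed by the pairs \<open>i \<le> j\<close> themselves, so
  \<^typ>\<open>real^(12 utri)\<close> is the space of dimension 78 and \<^typ>\<open>real^(4 utri)\<close> that of dimension 10.
  The elements of the index types \<open>12\<close> and \<open>4\<close> are, in increasing order, \<open>0, 1, 2, \<dots>\<close>, so the
  first coordinate has index \<open>0\<close> (and \<open>(4::4) = 0\<close>).
\<close>

definition urow :: "'n::linorder utri \<Rightarrow> 'n" where
  "urow p = fst (Rep_utri p)"

definition ucol :: "'n::linorder utri \<Rightarrow> 'n" where
  "ucol p = snd (Rep_utri p)"

definition uvec :: "real^('n::{finite,linorder})^('n::{finite,linorder}) \<Rightarrow> real^('n::{finite,linorder} utri)" where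
  "uvec M = (\<chi> p. M $ urow p $ ucol p)"

definition smat :: "real^('n::{finite,linorder} utri) \<Rightarrow> real^('n::{finite,linorder})^('n::{finite,linorder})" where
  "smat w = (\<chi> i j. w $ Abs_utri (min i j, max i j))"

definition quad_basis :: "real^('n::{finite,linorder}) \<Rightarrow> real^('n::{finite,linorder} utri)" where
  "quad_basis x = (\<chi> p. if urow p = ucol p then (x $ urow p)\<^sup>2 else 2 * x $ urow p * x $ ucol p)"

definition sigma_R2 :: "real^('m::{finite,linorder}) \<Rightarrow> real^('m::{finite,linorder} utri)^('m::{finite,linorder})" where
  "sigma_R2 u = matrix (\<lambda>w. smat w *v u)"

text \<open>The upper-triangular index pairs for \<open>4 \<times> 4\<close> matrices, without the first one.\<close>

definition utri_first :: "4 utri" where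
  "utri_first = Abs_utri (0, 0)"

typedef utri4_tail = "{p :: 4 utri. p \<noteq> utri_first}"
proof -
  have "Rep_utri (Abs_utri (1::4, 1)) \<noteq> Rep_utri (Abs_utri (0::4, 0))"
    by (simp add: Abs_utri_inverse)
  then have "Abs_utri (1, 1) \<noteq> utri_first"
    unfolding utri_first_def by metis
  then show ?thesis
    by blast
qed

instance utri4_tail :: finite
proof
  have "inj Rep_utri4_tail"
    by (meson injI Rep_utri4_tail_inject)
  then show "finite (UNIV :: utri4_tail set)"
    by (rule finite_imageD[rotated]) (rule finite_class.finite)
qed

text \<open>Coordinates of the estimate, in the blocks \<open>S\<close>, \<open>Q\<close>, and \<open>R\<close> without its first weight.\<close>

type_synonym widx = "12 utri + 12 utri + utri4_tail"

definition r1 :: real where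
  "r1 = 1"

definition W_S :: "real^widx \<Rightarrow> real^(12 utri)" where
  "W_S w = (\<chi> p. w $ Inl p)"

definition W_Q :: "real^widx \<Rightarrow> real^(12 utri)" where
  "W_Q w = (\<chi> p. w $ Inr (Inl p))"

definition W_R :: "real^widx \<Rightarrow> real^(4 utri)" where
  "W_R w = (\<chi> p. if p = utri_first then r1 else w $ Inr (Inr (Abs_utri4_tail p)))"

definition S_hat :: "real^widx \<Rightarrow> real^12^12" where
  "S_hat w = smat (W_S w)"

definition Q_hat :: "real^widx \<Rightarrow> real^12^12" where
  "Q_hat w = smat (W_Q w)"

definition R_hat :: "real^widx \<Rightarrow> real^4^4" where
  "R_hat w = smat (W_R w)"


subsection \<open>Consistency of the encoding\<close>

lemma Rep_utri_le: "urow p \<le> ucol p"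
  using Rep_utri[of p] by (simp add: urow_def ucol_def)

lemma uvec_smat: "uvec (smat w) = w"
  using Rep_utri_le
  by (auto simp: vec_eq_iff uvec_def smat_def min_def max_def urow_def ucol_def Rep_utri_inverse)

lemma symmetric_smat: "symmetric_mat (smat w)"
  by (simp add: symmetric_mat_def smat_def transpose_def vec_eq_iff min.commute max.commute)

lemma smat_uvec:
  assumes "symmetric_mat M"
  shows "smat (uvec M) = M"
proof -
  have sym: "M $ i $ j = M $ j $ i" for i j
  proof -
    have "transpose M $ i $ j = M $ i $ j"
      using assms by (simp only: symmetric_mat_def)
    then show ?thesis
      by (simp add: transpose_def)
  qed
  have "smat (uvec M) $ i $ j = M $ min i j $ max i j" for i j
    by (simp add: uvec_def smat_def urow_def ucol_def Abs_utri_inverse min.coboundedI1)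
  moreover have "M $ min i j $ max i j = M $ i $ j" for i j
    by (cases "i \<le> j") (simp_all add: min_def max_def sym[of j i])
  ultimately show ?thesis
    by (simp add: vec_eq_iff)
qed

lemma inner_quad_basis:
  fixes x :: "real^('n::{finite,linorder})"
  shows "w \<bullet> quad_basis x = x \<bullet> (smat w *v x)"
proof -
  define g :: "'n \<times> 'n \<Rightarrow> real" where
    "g q = w $ Abs_utri (min (fst q) (snd q), max (fst q) (snd q)) * (x $ fst q * x $ snd q)" for q
  define h where "h q = (if fst q = snd q then g q else 2 * g q)" for q
  let ?L = "{q :: 'n \<times> 'n. fst q < snd q}" and ?G = "{q :: 'n \<times> 'n. snd q < fst q}"
    and ?D = "{q :: 'n \<times> 'n. fst q = snd q}"
  have bij: "bij_betw Rep_utri (UNIV :: 'n utri set) (?L \<union> ?D)"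
  proof -
    have "range (Rep_utri :: 'n utri \<Rightarrow> 'n \<times> 'n) = {q. fst q \<le> snd q}"
      by (rule type_definition.Rep_range[OF type_definition_utri])
    moreover have "\<dots> = ?L \<union> ?D"
      by (simp add: set_eq_iff le_less)
    ultimately show ?thesis
      by (simp add: bij_betw_def inj_on_def Rep_utri_inject)
  qed
  have swap: "sum g ?G = sum g ?L"
    by (rule sum.reindex_bij_witness[where i = prod.swap and j = prod.swap])
       (auto simp: g_def min.commute max.commute)
  have "w $ p * quad_basis x $ p = h (Rep_utri p)" for p
  proof -
    have rep: "Rep_utri p = (urow p, ucol p)"
      by (simp add: urow_def ucol_def)
    then have "Abs_utri (urow p, ucol p) = p"
      by (metis Rep_utri_inverse)
    then have g: "g (Rep_utri p) = w $ p * (x $ urow p * x $ ucol p)"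
      using Rep_utri_le[of p] by (simp add: g_def rep min_absorb1 max_absorb2)
    show ?thesis
      unfolding h_def g by (simp add: quad_basis_def urow_def ucol_def power2_eq_square)
  qed
  then have "w \<bullet> quad_basis x = (\<Sum>p\<in>UNIV. h (Rep_utri p))"
    by (simp add: inner_vec_def)
  also have "\<dots> = sum h (?L \<union> ?D)"
    by (rule sum.reindex_bij_betw[OF bij])
  also have "\<dots> = sum h ?L + sum h ?D"
    by (rule sum.union_disjoint) auto
  also have "sum h ?L = sum g ?L + sum g ?L"
    unfolding sum.distrib[symmetric] by (rule sum.cong) (auto simp: h_def)
  also have "sum h ?D = sum g ?D"
    by (rule sum.cong) (auto simp: h_def)
  also have "sum g ?L + sum g ?L + sum g ?D = sum g (?L \<union> ?G) + sum g ?D"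
    by (subst sum.union_disjoint) (auto simp: swap)
  also have "\<dots> = sum g ((?L \<union> ?G) \<union> ?D)"
    by (rule sum.union_disjoint[symmetric]) auto
  also have "(?L \<union> ?G) \<union> ?D = UNIV \<times> UNIV"
    by (simp add: set_eq_iff neq_iff[symmetric])
  also have "sum g (UNIV \<times> UNIV) = (\<Sum>i\<in>UNIV. \<Sum>j\<in>UNIV. g (i, j))"
    by (simp add: sum.cartesian_product)
  also have "\<dots> = x \<bullet> (smat w *v x)"
    by (simp add: inner_vec_def matrix_vector_mult_def smat_def g_def sum_distrib_left ac_simps)
  finally show ?thesis .
qed

lemma linear_smat_mult: "Vector_Spaces.linear (*s) (*s) (\<lambda>w. smat w *v u)"
  by unfold_locales
     (simp_all add: vec_eq_iff smat_def matrix_vector_mult_def sum.distrib sum_distrib_left algebra_simps)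

lemma sigma_R2_smat: "sigma_R2 u *v w = smat w *v u"
  unfolding sigma_R2_def by (rule matrix_works[OF linear_smat_mult])


section \<open>History stack\<close>

text \<open>
  Slot \<open>i\<close> of the stack holds at time \<open>t\<close> the data recorded at time \<open>s\<close> if \<open>ti i t = Some s\<close>,
  and is not filled yet if \<open>ti i t = None\<close>.  The condition \<open>s \<le> t\<close> makes the slots empty
  initially, up to data recorded at time \<open>0\<close> itself.
\<close>

definition sampling_instants :: "real \<Rightarrow> real set" where
  "sampling_instants \<tau> = range (\<lambda>k::nat. real k * \<tau>)"

definition recording_times :: "real \<Rightarrow> ('N \<Rightarrow> real \<Rightarrow> real option) \<Rightarrow> bool" where
  "recording_times \<tau> ti \<longleftrightarrow>
     (\<forall>i t s. 0 \<le> t \<longrightarrow> ti i t = Some s \<longrightarrow> 0 \<le> s \<and> s \<le> t) \<and>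
     (\<forall>i t t'. 0 \<le> t \<longrightarrow> t \<le> t' \<longrightarrow> ti i t \<noteq> None \<longrightarrow> ti i t' \<noteq> None) \<and>
     (\<forall>i t t'. 0 \<le> t \<longrightarrow> t \<le> t' \<longrightarrow> {t..t'} \<inter> sampling_instants \<tau> = {} \<longrightarrow> ti i t' = ti i t)"

definition recorded :: "('N \<Rightarrow> real \<Rightarrow> real option) \<Rightarrow> (real \<Rightarrow> 'v::zero) \<Rightarrow> real \<Rightarrow> 'N \<Rightarrow> 'v" where
  "recorded ti Y t i = (case ti i t of None \<Rightarrow> 0 | Some s \<Rightarrow> Y s)"

definition sigma_delta ::
  "real^12^12 \<Rightarrow> real^4^12 \<Rightarrow> real^12 \<Rightarrow> real^4 \<Rightarrow> real^widx" where
  "sigma_delta A B x u = (\<chi> k. case k of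
       Inl p \<Rightarrow> (jacobian quad_basis (at x) *v (A *v x + B *v u)) $ p
     | Inr (Inl p) \<Rightarrow> quad_basis x $ p
     | Inr (Inr q) \<Rightarrow> quad_basis u $ Rep_utri4_tail q)"

definition sigma_Delta_u :: "real^4^12 \<Rightarrow> real^12 \<Rightarrow> real^4 \<Rightarrow> real^widx^4" where
  "sigma_Delta_u B x u = (\<chi> j k. case k of
       Inl p \<Rightarrow> (transpose B ** transpose (jacobian quad_basis (at x))) $ j $ p
     | Inr (Inl p) \<Rightarrow> 0
     | Inr (Inr q) \<Rightarrow> 2 * sigma_R2 u $ j $ Rep_utri4_tail q)"

text \<open>The five rows contributed by slot \<open>i\<close> are \<open>(i, Inl ())\<close> and \<open>(i, Inr j)\<close> for \<open>j :: 4\<close>.\<close>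

definition Sigma_stack ::
  "real^12^12 \<Rightarrow> real^4^12 \<Rightarrow> ('N::finite \<Rightarrow> real \<Rightarrow> real option) \<Rightarrow>
     (real \<Rightarrow> real^12) \<Rightarrow> (real \<Rightarrow> real^4) \<Rightarrow> real \<Rightarrow> real^widx^('N \<times> (unit + 4))" where
  "Sigma_stack A B ti X U t = (\<chi> r. case r of
       (i, Inl _) \<Rightarrow> sigma_delta A B (recorded ti X t i) (recorded ti U t i)
     | (i, Inr j) \<Rightarrow> sigma_Delta_u B (recorded ti X t i) (recorded ti U t i) $ j)"

definition Sigma_u_stack ::
  "('N::finite \<Rightarrow> real \<Rightarrow> real option) \<Rightarrow> (real \<Rightarrow> real^4) \<Rightarrow> real \<Rightarrow> real^('N \<times> (unit + 4))" where
  "Sigma_u_stack ti U t = (\<chi> r. case r of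
       (i, Inl _) \<Rightarrow> - ((recorded ti U t i $ 0)\<^sup>2 * r1)
     | (i, Inr j) \<Rightarrow> if j = 0 then - (2 * recorded ti U t i $ 0 * r1) else 0)"

definition X_data ::
  "('N::finite \<Rightarrow> real \<Rightarrow> real option) \<Rightarrow> (real \<Rightarrow> real^12) \<Rightarrow> real \<Rightarrow> real^'N^12" where
  "X_data ti X t = transpose (\<chi> i. recorded ti X t i)"

definition outer :: "real^'n \<Rightarrow> real^'n^'n" where
  "outer x = (\<chi> i j. x $ i * x $ j)"

definition Z_data ::
  "('N::finite \<Rightarrow> real \<Rightarrow> real option) \<Rightarrow> (real \<Rightarrow> real^12) \<Rightarrow> real \<Rightarrow> real^'N^(12 utri)" where
  "Z_data ti X t = transpose (\<chi> i. uvec (outer (recorded ti X t i)))"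


section \<open>Update law\<close>

definition reg_gram :: "real \<Rightarrow> real^'k^'r \<Rightarrow> real^'k^'k" where
  "reg_gram \<epsilon> M = transpose M ** M + \<epsilon> *\<^sub>R mat 1"

text \<open>
  The right-hand side jumps at sampling instants, so a solution is a continuous function that
  satisfies the differential equation between them.  The equation is meaningless, and imposes
  nothing, at times where the regularized Gram matrix is singular (possible for \<open>\<epsilon> = 0\<close> as long
  as the stack holds too little data).
\<close>

definition update_law_solution ::
  "real \<Rightarrow> real \<Rightarrow> (real \<Rightarrow> real^'k^'r) \<Rightarrow> (real \<Rightarrow> real^'r) \<Rightarrow> (real \<Rightarrow> real^'k) \<Rightarrow> bool" where
  "update_law_solution \<tau> \<epsilon> M b W \<longleftrightarrow>
     continuous_on {0..} W \<and>
     (\<forall>t\<ge>0. t \<notin> sampling_instants \<tau> \<longrightarrow> invertible (reg_gram \<epsilon> (M t)) \<longrightarrow>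
        (W has_vector_derivative
           (matrix_inv (reg_gram \<epsilon> (M t)) ** transpose (M t)) *v (b t - M t *v W t)) (at t))"

end

theory Submission
  imports Defs
begin

text \<open>
  For data obeying \<open>U = - K X\<close>, the residual \<open>\<Sigma> w - \<Sigma>\<^sub>u\<close> consists of the values at the recorded
  states of a quadratic form (the Riccati residual in closed-loop form) and of a linear map
  (\<open>B\<^sup>T S - R K\<close>), both affine in \<open>w\<close>.  Excitation makes these values determine the form and the
  map, with a lower bound that is uniform in time.  Hence, although the stack may be rewritten
  forever, the kernel of \<open>\<Sigma> t\<close> and the solutions of \<open>\<Sigma> t w = \<Sigma>\<^sub>u t\<close> do not depend on \<open>t \<ge> T\<close>.
  The update law keeps the component of \<open>W\<close> along that kernel fixed and contracts the orthogonal
  component of the error exponentially, so \<open>W\<close> converges to a common solution; the bound on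
  \<open>R\<^sup>-\<^sup>1\<close> keeps the limit of \<open>R\<close> invertible, and both residuals vanish there.
\<close>

section \<open>Linear algebra\<close>

lemma inner_transpose_mult:
  fixes M :: "real^'k^'r"
  shows "v \<bullet> (transpose M *v w) = (M *v v) \<bullet> w"
  by (metis dot_lmul_matrix inner_commute transpose_matrix_vector)

lemma inner_symmetric_mult:
  fixes M :: "real^'n^'n"
  assumes "symmetric_mat M"
  shows "v \<bullet> (M *v w) = w \<bullet> (M *v v)"
  by (metis inner_transpose_mult inner_commute assms symmetric_mat_def)

lemma norm_matrix_vector_mult_le:
  fixes M :: "real^'k^'r"
  shows "norm (M *v x) \<le> norm M * norm x"
proof -
  have "norm (M *v x) = L2_set (\<lambda>i. \<bar>M $ i \<bullet> x\<bar>) UNIV"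
    by (simp add: norm_vec_def matrix_vector_mul_component)
  also have "\<dots> \<le> L2_set (\<lambda>i. norm (M $ i) * norm x) UNIV"
    by (rule L2_set_mono) (auto simp: Cauchy_Schwarz_ineq2)
  also have "\<dots> = norm M * norm x"
    by (simp add: norm_vec_def[of M] L2_set_left_distrib)
  finally show ?thesis .
qed

lemma matrix_inv_inverse:
  fixes M :: "real^'k^'k"
  assumes "invertible M"
  shows "matrix_inv M ** M = mat 1" "M ** matrix_inv M = mat 1"
  using assms someI_ex[of "\<lambda>M'. M ** M' = mat 1 \<and> M' ** M = mat 1"]
  unfolding matrix_inv_def invertible_def by blast+

text \<open>Eigenvectors for distinct eigenvalues are orthogonal, hence independent, so there are
  only finitely many. Finiteness is what gives \<open>Min (eig M)\<close> its meaning as a lower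
  bound.\<close>

lemma finite_eig_symmetric:
  fixes M :: "real^'n^'n"
  assumes "symmetric_mat M"
  shows "finite (eig M)"
proof -
  obtain f where f: "\<And>l. l \<in> eig M \<Longrightarrow> f l \<noteq> 0 \<and> M *v f l = l *s f l"
    using that[of "\<lambda>l. SOME v. v \<noteq> 0 \<and> M *v v = l *s v"]
    unfolding eig_def mem_Collect_eq by (metis (mono_tags, lifting) someI_ex)
  have orth: "f l \<bullet> f m = 0" if "l \<in> eig M" "m \<in> eig M" "l \<noteq> m" for l m
  proof -
    have "f l \<bullet> (M *v f m) = (M *v f l) \<bullet> f m"
      by (metis inner_transpose_mult assms symmetric_mat_def)
    then have "m * (f l \<bullet> f m) = l * (f l \<bullet> f m)"
      using f[OF that(1)] f[OF that(2)] by (simp add: scalar_mult_eq_scaleR)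
    then show ?thesis
      using that(3) by simp
  qed
  have inj: "inj_on f (eig M)"
  proof (rule inj_onI, rule ccontr)
    fix l m assume "l \<in> eig M" "m \<in> eig M" "f l = f m" "l \<noteq> m"
    then have "f l \<bullet> f l = 0" using orth[of l m] by simp
    then show False using f \<open>l \<in> eig M\<close> by simp
  qed
  have "pairwise orthogonal (f ` eig M)"
    unfolding pairwise_def orthogonal_def using orth by blast
  moreover have "0 \<notin> f ` eig M"
    using f by force
  ultimately have "finite (f ` eig M)"
    by (intro independent_imp_finite pairwise_orthogonal_independent)
  then show ?thesis
    using inj finite_imageD by blast
qed

text \<open>The minimum of the quadratic form on the unit sphere is an eigenvalue.\<close>

lemma symmetric_eig_lower_bound:
  fixes M :: "real^'n^'n"
  assumes sym: "symmetric_mat M" and lb: "\<And>l. l \<in> eig M \<Longrightarrow> c \<le> l"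
  shows "c * (v \<bullet> v) \<le> v \<bullet> (M *v v)"
proof -
  have "continuous_on (sphere 0 1) (\<lambda>x::real^'n. x \<bullet> (M *v x))"
    by (intro continuous_intros)
  moreover have "axis undefined 1 \<in> (sphere 0 1 :: (real^'n) set)"
    by simp
  ultimately obtain x where x: "norm x = 1" and min: "\<And>y. norm y = 1 \<Longrightarrow> x \<bullet> (M *v x) \<le> y \<bullet> (M *v y)"
    using continuous_attains_inf[of "sphere 0 1" "\<lambda>x::real^'n. x \<bullet> (M *v x)"]
    by (metis compact_sphere empty_iff mem_sphere_0)
  define l where "l = x \<bullet> (M *v x)"
  have ge: "l * (y \<bullet> y) \<le> y \<bullet> (M *v y)" for y
  proof (cases "y = 0")
    case False
    have "l \<le> (y /\<^sub>R norm y) \<bullet> (M *v (y /\<^sub>R norm y))"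
      unfolding l_def by (rule min) (use False in simp)
    also have "\<dots> = (y \<bullet> (M *v y)) / (norm y)\<^sup>2"
      by (simp add: matrix_vector_mult_scaleR power2_eq_square divide_simps)
    finally show ?thesis
      using False by (simp add: power2_norm_eq_inner[symmetric] field_simps)
  qed simp
  \<comment> \<open>First variation at the minimizer \<open>x\<close> in the direction of the residual \<open>r\<close>.\<close>
  define r where "r = M *v x - l *\<^sub>R x"
  have quad: "0 \<le> 2 * s * (r \<bullet> r) + s\<^sup>2 * (r \<bullet> (M *v r) - l * (r \<bullet> r))" for s
  proof -
    have e1: "l * ((x + s *\<^sub>R r) \<bullet> (x + s *\<^sub>R r)) = l + 2 * (s * (l * (r \<bullet> x))) + s\<^sup>2 * (l * (r \<bullet> r))"
      using x by (simp add: norm_eq_1 inner_add_left inner_add_right inner_commute[of x r]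
          power2_eq_square algebra_simps)
    have e2: "(x + s *\<^sub>R r) \<bullet> (M *v (x + s *\<^sub>R r)) =
        l + 2 * (s * (r \<bullet> (M *v x))) + s\<^sup>2 * (r \<bullet> (M *v r))"
      by (simp add: l_def matrix_vector_right_distrib matrix_vector_mult_scaleR inner_add_left
          inner_add_right inner_symmetric_mult[OF sym, of x r] power2_eq_square algebra_simps)
    have e3: "s * (r \<bullet> r) = s * (r \<bullet> (M *v x)) - s * (l * (r \<bullet> x))"
      by (subst (2) r_def) (simp add: inner_diff_right algebra_simps)
    show ?thesis
      using ge[of "x + s *\<^sub>R r"] e3 unfolding e1 e2 by (simp add: right_diff_distrib)
  qed
  have "r \<bullet> r = 0"
  proof (rule ccontr)
    assume "r \<bullet> r \<noteq> 0"
    then have p: "0 < r \<bullet> r" by simp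
    \<comment> \<open>An upper bound on the coefficient of \<open>s\<^sup>2\<close>, made positive
      by the added 1. The \<open>s\<close> chosen next minimizes
      \<open>2 * s * (r \<bullet> r) + s\<^sup>2 * d\<close>.\<close>
    define d where "d = \<bar>r \<bullet> (M *v r) - l * (r \<bullet> r)\<bar> + 1"
    have d: "d > 0" "r \<bullet> (M *v r) - l * (r \<bullet> r) \<le> d" unfolding d_def by auto
    define s where "s = - ((r \<bullet> r) / d)"
    have "2 * s * (r \<bullet> r) + s\<^sup>2 * (r \<bullet> (M *v r) - l * (r \<bullet> r)) \<le> 2 * s * (r \<bullet> r) + s\<^sup>2 * d"
      using d by (simp add: mult_left_mono)
    also have "\<dots> = - ((r \<bullet> r)\<^sup>2 / d)"
      using d(1) by (simp add: s_def power2_eq_square divide_simps)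
    also have "\<dots> < 0"
      using p d by simp
    finally show False
      using quad[of s] by simp
  qed
  then have "M *v x = l *s x"
    by (simp add: r_def scalar_mult_eq_scaleR)
  moreover have "x \<noteq> 0" using x by auto
  ultimately have "l \<in> eig M"
    unfolding eig_def by blast
  then have "c * (v \<bullet> v) \<le> l * (v \<bullet> v)"
    using lb by (simp add: mult_right_mono)
  then show ?thesis
    using ge[of v] by simp
qed

text \<open>The quadratic form of \<open>D ** transpose D\<close> is a sum of squared products with
  the columns of \<open>D\<close>. This turns an eigenvalue condition on the recorded data into a
  bound on values at those data.\<close>

lemma gram_Min_eig_bound:
  fixes D :: "real^'N^'n"
  assumes "Min (eig (D ** transpose D)) > c"
  shows "c * (v \<bullet> v) \<le> (\<Sum>i\<in>UNIV. (v \<bullet> column i D)\<^sup>2)"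
proof -
  have sym: "symmetric_mat (D ** transpose D)"
    by (simp add: symmetric_mat_def matrix_transpose_mul transpose_transpose)
  have "c \<le> l" if "l \<in> eig (D ** transpose D)" for l
    using Min_le[OF finite_eig_symmetric[OF sym] that] assms by simp
  then have "c * (v \<bullet> v) \<le> v \<bullet> ((D ** transpose D) *v v)"
    by (rule symmetric_eig_lower_bound[OF sym])
  also have "\<dots> = (transpose D *v v) \<bullet> (transpose D *v v)"
    using inner_transpose_mult[of v "transpose D" "transpose D *v v"]
    by (simp add: matrix_vector_mul_assoc[symmetric] transpose_transpose)
  also have "\<dots> = (\<Sum>i\<in>UNIV. (v \<bullet> column i D)\<^sup>2)"
    by (subst inner_vec_def)
      (simp add: matrix_vector_mul_component power2_eq_square inner_commute transpose_def column_def
        del: transpose_matrix_vector)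
  finally show ?thesis .
qed

text \<open>Invertibility is not a closed condition, but the estimate
  \<open>norm v \<le> c * norm (M t *v v)\<close> supplied by the inverses passes to the limit and
  makes \<open>L\<close> injective.\<close>

lemma invertible_limit:
  fixes M :: "'a \<Rightarrow> real^'n^'n"
  assumes lim: "(M \<longlongrightarrow> L) F" and "F \<noteq> bot"
    and inv: "\<forall>\<^sub>F t in F. invertible (M t) \<and> norm (matrix_inv (M t)) \<le> c"
  shows "invertible L"
proof -
  have bound: "norm v \<le> c * norm (L *v v)" for v
  proof (rule tendsto_le[OF \<open>F \<noteq> bot\<close> _ tendsto_const])
    have "((\<lambda>t. M t *v v) \<longlongrightarrow> L *v v) F"
      unfolding matrix_vector_mult_def
      by (intro tendsto_vec_lambda tendsto_sum tendsto_mult tendsto_const tendsto_vec_nth lim)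
    then show "((\<lambda>t. c * norm (M t *v v)) \<longlongrightarrow> c * norm (L *v v)) F"
      by (intro tendsto_intros)
    show "\<forall>\<^sub>F t in F. norm v \<le> c * norm (M t *v v)"
      using inv
    proof eventually_elim
      case (elim t)
      have "v = matrix_inv (M t) *v (M t *v v)"
        using elim by (simp add: matrix_vector_mul_assoc matrix_inv_inverse)
      then have "norm v \<le> norm (matrix_inv (M t)) * norm (M t *v v)"
        by (metis norm_matrix_vector_mult_le)
      also have "\<dots> \<le> c * norm (M t *v v)"
        using elim by (simp add: mult_right_mono)
      finally show ?case .
    qed
  qed
  have "inj ((*v) L)"
  proof (rule injI)
    fix v w assume "L *v v = L *v w"
    then have "L *v (v - w) = 0" by (simp add: matrix_vector_mult_diff_distrib)
    then show "v = w" using bound[of "v - w"] by simp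
  qed
  then show ?thesis
    by (metis invertible_left_inverse matrix_left_invertible_injective)
qed

section \<open>Convergence of the update law\<close>

text \<open>Intended for solutions whose derivative is known only between sampling instants:
  continuity allows integration across finitely many exceptional points.\<close>

lemma nonincreasing_off_finite:
  fixes \<phi> :: "real \<Rightarrow> real"
  assumes "a \<le> b" "finite F" "continuous_on {a..b} \<phi>"
    and deriv: "\<And>t. t \<in> {a<..<b} - F \<Longrightarrow> \<exists>d\<le>0. (\<phi> has_vector_derivative d) (at t)"
  shows "\<phi> b \<le> \<phi> a"
proof -
  obtain d where d: "\<And>t. t \<in> {a<..<b} - F \<Longrightarrow> d t \<le> 0 \<and> (\<phi> has_vector_derivative d t) (at t)"
    using deriv by metis
  \<comment> \<open>The value 0 at the end points and exceptional points keeps the integrand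
    nonpositive on the whole interval.\<close>
  define d' where "d' t = (if t \<in> {a<..<b} - F then d t else 0)" for t
  have "(d' has_integral (\<phi> b - \<phi> a)) {a..b}"
    by (rule fundamental_theorem_of_calculus_interior_strong[OF assms(2,1) _ assms(3)])
      (use d in \<open>auto simp: d'_def\<close>)
  then have "\<phi> b - \<phi> a \<le> 0"
    by (rule has_integral_le[OF _ has_integral_0]) (use d in \<open>auto simp: d'_def\<close>)
  then show ?thesis by simp
qed

lemma finite_sampling_instants:
  assumes "\<tau> > 0"
  shows "finite ({a..b} \<inter> sampling_instants \<tau>)"
proof -
  have "{a..b} \<inter> sampling_instants \<tau> \<subseteq> (\<lambda>k. real k * \<tau>) ` {..nat \<lceil>b / \<tau>\<rceil>}"
  proof
    fix t assume "t \<in> {a..b} \<inter> sampling_instants \<tau>"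
    then obtain k :: nat where k: "t = real k * \<tau>" "real k * \<tau> \<le> b"
      by (auto simp: sampling_instants_def)
    then have "real k \<le> b / \<tau>"
      using assms by (simp add: field_simps)
    then have "k \<le> nat \<lceil>b / \<tau>\<rceil>"
      by linarith
    then show "t \<in> (\<lambda>k. real k * \<tau>) ` {..nat \<lceil>b / \<tau>\<rceil>}"
      using k by auto
  qed
  then show ?thesis
    by (rule finite_subset) simp
qed

section \<open>The vector field of the regularized update law\<close>

lemma reg_gram_mult: "reg_gram \<epsilon> M *v y = transpose M *v (M *v y) + \<epsilon> *\<^sub>R y"
  by (simp add: reg_gram_def matrix_vector_mult_add_rdistrib matrix_vector_mul_assoc
      scaleR_matrix_vector_assoc[symmetric])

text \<open>\<open>transpose M ** M\<close> commutes with \<open>reg_gram \<epsilon> M\<close>,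
  hence with its inverse. With \<open>z\<close> the inverse applied to \<open>v\<close>, the flow
  can be written without any inverse.\<close>

lemma reg_gram_flow:
  fixes M :: "real^'k^'r"
  assumes inv: "invertible (reg_gram \<epsilon> M)"
  obtains z where "v = transpose M *v (M *v z) + \<epsilon> *\<^sub>R z"
    and "(matrix_inv (reg_gram \<epsilon> M) ** transpose M) *v (M *v v) = transpose M *v (M *v z)"
proof -
  let ?G = "reg_gram \<epsilon> M"
  define z where "z = matrix_inv ?G *v v"
  define g where "g = transpose M *v (M *v z)"
  have v_eq: "v = g + \<epsilon> *\<^sub>R z"
  proof -
    have "?G *v z = v"
      using inv by (simp add: z_def matrix_vector_mul_assoc matrix_inv_inverse)
    then show ?thesis
      by (simp add: reg_gram_mult g_def)
  qed
  have "transpose M *v (M *v v) = ?G *v g"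
    by (subst v_eq, simp only: reg_gram_mult)
      (simp add: matrix_vector_right_distrib matrix_vector_mult_scaleR g_def del: transpose_matrix_vector)
  then have "(matrix_inv ?G ** transpose M) *v (M *v v) = (matrix_inv ?G ** ?G) *v g"
    by (simp add: matrix_vector_mul_assoc[symmetric] del: transpose_matrix_vector)
  then show ?thesis
    using inv v_eq that by (simp add: matrix_inv_inverse g_def)
qed

text \<open>The flow lies in the range of \<open>transpose M\<close>, which is orthogonal to the
  kernel of \<open>M\<close>.\<close>

lemma reg_gram_flow_orthogonal_kernel:
  fixes M :: "real^'k^'r"
  assumes "invertible (reg_gram \<epsilon> M)" and "M *v n = 0"
  shows "n \<bullet> ((matrix_inv (reg_gram \<epsilon> M) ** transpose M) *v (M *v v)) = 0"
proof -
  obtain z where "(matrix_inv (reg_gram \<epsilon> M) ** transpose M) *v (M *v v) = transpose M *v (M *v z)"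
    using reg_gram_flow[OF assms(1), of v] by blast
  then show ?thesis
    using assms(2) by (simp add: inner_transpose_mult del: transpose_matrix_vector)
qed

text \<open>With \<open>v = g + \<epsilon> *\<^sub>R z\<close>, both sides expand in
  \<open>g \<bullet> g\<close>, \<open>q\<close> and \<open>z \<bullet> z\<close>, and only the last
  needs \<open>bound\<close>. The factor involves no upper bound on \<open>M\<close>, so it is
  uniform in time whenever \<open>c\<close> is.\<close>

lemma reg_gram_flow_coercive:
  fixes M :: "real^'k^'r"
  assumes "\<epsilon> \<ge> 0" and inv: "invertible (reg_gram \<epsilon> M)"
    and ker: "\<And>n. n \<in> N \<Longrightarrow> M *v n = 0"
    and v: "\<And>n. n \<in> N \<Longrightarrow> n \<bullet> v = 0"
    and "c > 0" and bound: "\<And>v. (\<And>n. n \<in> N \<Longrightarrow> n \<bullet> v = 0) \<Longrightarrow> c * (v \<bullet> v) \<le> (M *v v) \<bullet> (M *v v)"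
  shows "v \<bullet> v \<le> (2 + \<epsilon> / c) * (v \<bullet> ((matrix_inv (reg_gram \<epsilon> M) ** transpose M) *v (M *v v)))"
proof -
  obtain z where v_eq: "v = transpose M *v (M *v z) + \<epsilon> *\<^sub>R z"
    and y: "(matrix_inv (reg_gram \<epsilon> M) ** transpose M) *v (M *v v) = transpose M *v (M *v z)"
    using reg_gram_flow[OF inv] by blast
  define g where "g = transpose M *v (M *v z)"
  define q where "q = (M *v z) \<bullet> (M *v z)"
  have q: "z \<bullet> g = q" "g \<bullet> z = q"
    by (simp_all add: g_def q_def inner_transpose_mult inner_commute[of _ z] del: transpose_matrix_vector)
  \<comment> \<open>For \<open>\<epsilon> = 0\<close> this is trivial. Otherwise \<open>z\<close> is
    orthogonal to \<open>N\<close> because \<open>v\<close> and \<open>g\<close> are, so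
    \<open>bound\<close> applies to \<open>z\<close>.\<close>
  have key: "\<epsilon> * (\<epsilon> * (z \<bullet> z)) \<le> \<epsilon> * (\<epsilon> / c * q)"
  proof (cases "\<epsilon> = 0")
    case False
    have "n \<bullet> z = 0" if "n \<in> N" for n
    proof -
      have "n \<bullet> g = 0"
        using ker[OF that] by (simp add: g_def inner_transpose_mult del: transpose_matrix_vector)
      then show ?thesis
        using v[OF that] v_eq[folded g_def] False by (simp add: inner_add_right)
    qed
    then have "c * (z \<bullet> z) \<le> q"
      unfolding q_def by (rule bound)
    then have "z \<bullet> z \<le> q / c"
      using \<open>c > 0\<close> by (simp add: field_simps)
    then have "\<epsilon> * (\<epsilon> * (z \<bullet> z)) \<le> \<epsilon> * (\<epsilon> * (q / c))"
      using \<open>\<epsilon> \<ge> 0\<close> by (intro mult_left_mono)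
    then show ?thesis by simp
  qed simp
  have vv: "v \<bullet> v = g \<bullet> g + 2 * (\<epsilon> * q) + \<epsilon> * (\<epsilon> * (z \<bullet> z))"
    using q unfolding v_eq[folded g_def] by (simp add: inner_add_left inner_add_right algebra_simps)
  have vy: "v \<bullet> g = g \<bullet> g + \<epsilon> * q"
    using q unfolding v_eq[folded g_def] by (simp add: inner_add_left)
  have "0 \<le> (1 + \<epsilon> / c) * (g \<bullet> g)"
    using \<open>\<epsilon> \<ge> 0\<close> \<open>c > 0\<close> by simp
  then show ?thesis
    using key unfolding y g_def[symmetric] vv vy by (simp add: algebra_simps)
qed

text \<open>
  The kernels of the \<open>M t\<close> all coincide with that of \<open>\<Lambda>\<close>, so the limit is the orthogonal
  projection of \<open>W T\<close> onto the affine space of common solutions of \<open>M t *v w = b t\<close>.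
\<close>

lemma update_law_converges:
  fixes M :: "real \<Rightarrow> real^'k^'r" and \<Lambda> :: "real^'k \<Rightarrow> 'v::euclidean_space"
  assumes "\<tau> > 0" "T \<ge> 0" "\<epsilon> \<ge> 0" "c > 0"
    and law: "update_law_solution \<tau> \<epsilon> M b W"
    and inv: "\<And>t. t \<ge> T \<Longrightarrow> invertible (reg_gram \<epsilon> (M t))"
    and "linear \<Lambda>"
    and lower: "\<And>t v. t \<ge> T \<Longrightarrow> c * (\<Lambda> v \<bullet> \<Lambda> v) \<le> (M t *v v) \<bullet> (M t *v v)"
    and ker: "\<And>t v. t \<ge> T \<Longrightarrow> \<Lambda> v = 0 \<Longrightarrow> M t *v v = 0"
    and sol: "\<And>t. t \<ge> T \<Longrightarrow> M t *v w0 = b t"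
  obtains w where "(W \<longlongrightarrow> w) at_top" "\<Lambda> (w - w0) = 0"
proof -
  define N where "N = {v. \<Lambda> v = 0}"
  have N: "subspace N"
    unfolding N_def by (rule linear_subspace_kernel[OF \<open>linear \<Lambda>\<close>])
  \<comment> \<open>\<open>\<Lambda>\<close> is injective on the orthogonal complement of its
    kernel, so in finite dimension it is bounded below there. Together with \<open>lower\<close>
    this makes all \<open>M t\<close> coercive with one constant.\<close>
  obtain d where "d > 0" and d: "\<And>v. v \<in> N\<^sup>\<bottom> \<Longrightarrow> d * norm v \<le> norm (\<Lambda> v)"
  proof -
    have "\<forall>v\<in>N\<^sup>\<bottom>. \<Lambda> v = 0 \<longrightarrow> v = 0"
      by (auto simp: orthogonal_comp_def N_def orthogonal_self)
    then have "\<exists>d>0. \<forall>v\<in>N\<^sup>\<bottom>. d * norm v \<le> norm (\<Lambda> v)"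
      using \<open>linear \<Lambda>\<close>
      by (intro injective_imp_isometric closed_subspace subspace_orthogonal_comp) (auto simp: linear_conv_bounded_linear)
    then show ?thesis using that by blast
  qed
  define c' where "c' = c * d\<^sup>2"
  have "c' > 0" using \<open>c > 0\<close> \<open>d > 0\<close> by (simp add: c'_def)
  have bound: "c' * (v \<bullet> v) \<le> (M t *v v) \<bullet> (M t *v v)"
    if "t \<ge> T" and v: "\<And>n. n \<in> N \<Longrightarrow> n \<bullet> v = 0" for t v
  proof -
    have "v \<in> N\<^sup>\<bottom>"
      using v by (auto simp: orthogonal_comp_def orthogonal_def)
    then have "(d * norm v)\<^sup>2 \<le> (norm (\<Lambda> v))\<^sup>2"
      using d \<open>d > 0\<close> by (intro power_mono) auto
    then have "d\<^sup>2 * (v \<bullet> v) \<le> \<Lambda> v \<bullet> \<Lambda> v"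
      by (simp add: power_mult_distrib power2_norm_eq_inner)
    then have "c * (d\<^sup>2 * (v \<bullet> v)) \<le> c * (\<Lambda> v \<bullet> \<Lambda> v)"
      using \<open>c > 0\<close> by (simp add: mult_left_mono)
    then show ?thesis
      using lower[OF \<open>t \<ge> T\<close>, of v] by (simp add: c'_def mult.assoc)
  qed
  \<comment> \<open>\<open>p\<close> is the kernel part of the error at time \<open>T\<close>, which
    the flow never changes; adding it to \<open>w0\<close> singles out the solution that
    \<open>W\<close> approaches.\<close>
  obtain p z where "p \<in> span N" and z: "\<And>n. n \<in> span N \<Longrightarrow> orthogonal z n"
    and pz: "W T - w0 = p + z"
    using orthogonal_subspace_decomp_exists[of N "W T - w0"] by metis
  have p: "\<Lambda> p = 0"
    using \<open>p \<in> span N\<close> N by (metis N_def mem_Collect_eq span_eq_iff)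
  define w where "w = w0 + p"
  define e where "e t = W t - w" for t
  define y where "y t = (matrix_inv (reg_gram \<epsilon> (M t)) ** transpose (M t)) *v (M t *v e t)" for t
  have cont: "continuous_on {T..t} e" for t
    using law \<open>T \<ge> 0\<close> unfolding e_def update_law_solution_def
    by (intro continuous_intros) (auto elim: continuous_on_subset)
  have deriv: "(e has_vector_derivative - y t) (at t)"
    if "t \<ge> T" "t \<notin> sampling_instants \<tau>" for t
  proof -
    have "M t *v w = b t"
      using sol[OF \<open>t \<ge> T\<close>] ker[OF \<open>t \<ge> T\<close> p] by (simp add: w_def matrix_vector_right_distrib)
    then have "b t - M t *v W t = - (M t *v e t)"
      by (simp add: e_def matrix_vector_mult_diff_distrib)
    moreover have "(W has_vector_derivative
        (matrix_inv (reg_gram \<epsilon> (M t)) ** transpose (M t)) *v (b t - M t *v W t)) (at t)"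
      using law that inv[OF \<open>t \<ge> T\<close>] \<open>T \<ge> 0\<close> unfolding update_law_solution_def by auto
    ultimately have "(W has_vector_derivative - y t) (at t)"
      by (simp add: y_def vec.neg)
    then show ?thesis
      unfolding e_def by (auto intro!: derivative_eq_intros)
  qed
  have fin: "finite ({T..t} \<inter> sampling_instants \<tau>)" for t
    by (rule finite_sampling_instants[OF \<open>\<tau> > 0\<close>])
  have orthT: "n \<bullet> e T = 0" if "n \<in> N" for n
  proof -
    have "e T = z" using pz by (simp add: e_def w_def algebra_simps)
    then show ?thesis
      using z[OF span_base[OF that]] by (simp add: orthogonal_def inner_commute)
  qed
  have orth: "n \<bullet> e t = 0" if "n \<in> N" "t \<ge> T" for n t
  proof -
    have d0: "((\<lambda>s. r * (n \<bullet> e s)) has_vector_derivative 0) (at s)"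
      if s: "s \<in> {T<..<t} - ({T..t} \<inter> sampling_instants \<tau>)" for s r
    proof -
      have "n \<bullet> y s = 0"
        unfolding y_def using s inv ker \<open>n \<in> N\<close>
        by (intro reg_gram_flow_orthogonal_kernel) (auto simp: N_def)
      moreover have "(e has_vector_derivative - y s) (at s)"
        using s by (intro deriv) auto
      then have "((\<lambda>s. r * (n \<bullet> e s)) has_vector_derivative r * (n \<bullet> (- y s))) (at s)"
        by (intro has_vector_derivative_mult_right
            bounded_linear.has_vector_derivative[OF bounded_linear_inner_right])
      ultimately show ?thesis by simp
    qed
    \<comment> \<open>The cases \<open>r = 1\<close> and \<open>r = -1\<close> give both
      inequalities, so the component along \<open>n\<close> stays at its value at time
      \<open>T\<close>.\<close>
    have "r * (n \<bullet> e t) \<le> r * (n \<bullet> e T)" for r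
      by (rule nonincreasing_off_finite[OF \<open>t \<ge> T\<close> fin[of t]])
        (auto intro!: continuous_intros cont exI[of _ "0::real"] d0)
    from this[of 1] this[of "-1"] orthT[OF \<open>n \<in> N\<close>] show ?thesis by simp
  qed
  \<comment> \<open>The factor from \<open>reg_gram_flow_coercive\<close>:
    \<open>e t \<bullet> e t\<close> decays at rate \<open>2 / k\<close>, and the exponential weight
    in \<open>decay\<close> is the matching integrating factor.\<close>
  define k where "k = 2 + \<epsilon> / c'"
  have "k > 0"
    using \<open>\<epsilon> \<ge> 0\<close> \<open>c' > 0\<close> by (simp add: k_def add_pos_nonneg)
  have decay: "exp (2 / k * t) * (e t \<bullet> e t) \<le> exp (2 / k * T) * (e T \<bullet> e T)" if "t \<ge> T" for t
  proof (rule nonincreasing_off_finite[OF that fin[of t]])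
    show "continuous_on {T..t} (\<lambda>t. exp (2 / k * t) * (e t \<bullet> e t))"
      by (intro continuous_intros cont)
    fix s assume s: "s \<in> {T<..<t} - ({T..t} \<inter> sampling_instants \<tau>)"
    then have "s \<ge> T" by simp
    have "e s \<bullet> e s \<le> k * (e s \<bullet> y s)"
      unfolding k_def y_def
      by (rule reg_gram_flow_coercive[OF \<open>\<epsilon> \<ge> 0\<close> inv[OF \<open>s \<ge> T\<close>], of N])
        (use \<open>s \<ge> T\<close> \<open>c' > 0\<close> ker bound orth in \<open>auto simp: N_def\<close>)
    then have le: "2 / k * (e s \<bullet> e s) - 2 * (e s \<bullet> y s) \<le> 0"
      using \<open>k > 0\<close> by (simp add: field_simps)
    have "(e has_vector_derivative - y s) (at s)"
      using s by (intro deriv) auto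
    then have D: "((\<lambda>s. e s \<bullet> e s) has_vector_derivative (e s \<bullet> (- y s) + (- y s) \<bullet> e s)) (at s)"
      by (intro bounded_bilinear.has_vector_derivative[OF bounded_bilinear_inner])
    have "((\<lambda>t. exp (2 / k * t)) has_vector_derivative (2 / k * exp (2 / k * s))) (at s)"
      unfolding has_real_derivative_iff_has_vector_derivative[symmetric]
      using \<open>k > 0\<close> by (auto intro!: derivative_eq_intros)
    from has_vector_derivative_mult[OF this D]
    have "((\<lambda>t. exp (2 / k * t) * (e t \<bullet> e t)) has_vector_derivative
        exp (2 / k * s) * (2 / k * (e s \<bullet> e s) - 2 * (e s \<bullet> y s))) (at s)"
      by (simp add: algebra_simps inner_commute)
    then show "\<exists>d\<le>0. ((\<lambda>t. exp (2 / k * t) * (e t \<bullet> e t)) has_vector_derivative d) (at s)"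
      using le by (intro exI conjI) (auto simp: mult_nonneg_nonpos)
  qed
  define C where "C = exp (2 / k * T) * (e T \<bullet> e T)"
  have "((\<lambda>t. (norm (e t))\<^sup>2) \<longlongrightarrow> 0) at_top"
  proof (rule tendsto_sandwich[OF _ _ tendsto_const])
    show "\<forall>\<^sub>F t in at_top. 0 \<le> (norm (e t))\<^sup>2" by simp
    show "\<forall>\<^sub>F t in at_top. (norm (e t))\<^sup>2 \<le> C * exp (- (2 / k * t))"
      using eventually_ge_at_top[of T]
    proof eventually_elim
      case (elim t)
      then show ?case
        using decay[OF elim] by (simp add: C_def power2_norm_eq_inner exp_minus field_simps)
    qed
    have "filterlim (\<lambda>t. 2 / k * t) at_top at_top"
      using \<open>k > 0\<close> by (intro filterlim_tendsto_pos_mult_at_top[OF tendsto_const] filterlim_ident) auto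
    then have "((\<lambda>t. exp (- (2 / k * t))) \<longlongrightarrow> 0) at_top"
      by (intro filterlim_compose[OF exp_at_bot]) (simp add: filterlim_uminus_at_bot)
    then show "((\<lambda>t. C * exp (- (2 / k * t))) \<longlongrightarrow> 0) at_top"
      using tendsto_mult_right_zero by blast
  qed
  then have "(e \<longlongrightarrow> 0) at_top"
    by (simp add: tendsto_norm_zero_iff)
  then have "(W \<longlongrightarrow> w) at_top"
    unfolding e_def by (rule LIM_zero_cancel)
  moreover have "\<Lambda> (w - w0) = 0"
    using p by (simp add: w_def)
  ultimately show ?thesis ..
qed

section \<open>Quadratic basis functions\<close>

text \<open>Each component is a homogeneous quadratic, so its derivative is the part of the
  increment that is bilinear in \<open>x\<close> and \<open>h\<close>, given by
  polarization.\<close>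

lemma quad_basis_has_derivative:
  fixes x :: "real^('n::{finite,linorder})"
  shows "(quad_basis has_derivative (\<lambda>h. quad_basis (x + h) - quad_basis x - quad_basis h)) (at x)"
proof (subst has_derivative_componentwise_within, rule ballI)
  fix b :: "real^'n utri" assume "b \<in> Basis"
  then obtain p where b: "b = axis p 1"
    by (auto simp: Basis_vec_def)
  have "((\<lambda>x. quad_basis x $ p) has_derivative
      (\<lambda>h. quad_basis (x + h) $ p - quad_basis x $ p - quad_basis h $ p)) (at x)"
    by (cases "urow p = ucol p")
      (auto simp: quad_basis_def power2_eq_square algebra_simps intro!: derivative_eq_intros
          bounded_linear_imp_has_derivative[OF bounded_linear_vec_nth])
  then show "((\<lambda>x. quad_basis x \<bullet> b) has_derivative
      (\<lambda>h. (quad_basis (x + h) - quad_basis x - quad_basis h) \<bullet> b)) (at x)"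
    by (simp add: b cart_eq_inner_axis inner_diff_left)
qed

text \<open>Pairing the polarized derivative with \<open>w\<close> gives two mirror terms, which the
  symmetry of \<open>smat w\<close> merges.\<close>

lemma jacobian_quad_basis_inner:
  "(jacobian quad_basis (at x) *v h) \<bullet> w = 2 * (h \<bullet> (smat w *v x))"
proof -
  have "(\<lambda>h. jacobian quad_basis (at x) *v h) = (\<lambda>h. quad_basis (x + h) - quad_basis x - quad_basis h)"
  proof (rule has_derivative_unique[OF _ quad_basis_has_derivative])
    have "quad_basis differentiable at x"
      using quad_basis_has_derivative unfolding differentiable_def by blast
    then show "(quad_basis has_derivative (\<lambda>h. jacobian quad_basis (at x) *v h)) (at x)"
      by (simp add: jacobian_works)
  qed
  then have "(jacobian quad_basis (at x) *v h) \<bullet> w = w \<bullet> (quad_basis (x + h) - quad_basis x - quad_basis h)"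
    by (simp add: fun_eq_iff inner_commute)
  also have "\<dots> = x \<bullet> (smat w *v h) + h \<bullet> (smat w *v x)"
    by (simp add: inner_diff_right inner_quad_basis matrix_vector_right_distrib inner_add_left inner_add_right)
  finally show ?thesis
    using inner_symmetric_mult[OF symmetric_smat, of x w h] by simp
qed

lemma transpose_jacobian_quad_basis:
  "transpose (jacobian quad_basis (at x)) *v w = 2 *\<^sub>R (smat w *v x)"
  by (rule vector_eq_ldot[THEN iffD1], rule allI)
    (simp add: inner_transpose_mult jacobian_quad_basis_inner del: transpose_matrix_vector)

section \<open>Residuals of the stacked equations\<close>

lemma sum_widx:
  fixes f :: "widx \<Rightarrow> 'a::comm_monoid_add"
  shows "(\<Sum>k\<in>UNIV. f k) =
    (\<Sum>p\<in>UNIV. f (Inl p)) + ((\<Sum>p\<in>UNIV. f (Inr (Inl p))) + (\<Sum>q\<in>UNIV. f (Inr (Inr q))))"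
  by (simp add: UNIV_Plus_UNIV[symmetric] sum.Plus del: UNIV_Plus_UNIV)

text \<open>Separates the fixed weight \<open>r1\<close> from the nine estimated weights of the
  control cost.\<close>

lemma sum_utri_first:
  fixes f :: "4 utri \<Rightarrow> real"
  shows "(\<Sum>p\<in>UNIV. f p) = f utri_first + (\<Sum>q\<in>UNIV. f (Rep_utri4_tail q))"
proof -
  have "bij_betw Rep_utri4_tail UNIV (UNIV - {utri_first})"
    using type_definition.Rep_range[OF type_definition_utri4_tail]
    by (auto simp: bij_betw_def inj_on_def Rep_utri4_tail_inject)
  then have "(\<Sum>q\<in>UNIV. f (Rep_utri4_tail q)) = sum f (UNIV - {utri_first})"
    by (rule sum.reindex_bij_betw)
  then show ?thesis
    by (simp add: sum.remove[of UNIV utri_first])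
qed

lemma W_R_utri_first: "W_R w $ utri_first = r1"
  by (simp add: W_R_def)

lemma W_R_tail: "W_R w $ Rep_utri4_tail q = w $ Inr (Inr q)"
  using Rep_utri4_tail[of q] by (simp add: W_R_def Rep_utri4_tail_inverse)

lemma utri_first_row_col: "urow utri_first = 0" "ucol utri_first = 0"
  by (simp_all add: urow_def ucol_def utri_first_def Abs_utri_inverse)

text \<open>The regressor omits the coordinate of the fixed weight \<open>r1\<close>. The term added
  on the left restores it and is the negative of the matching entry of
  \<open>Sigma_u_stack\<close>.\<close>

lemma sigma_delta_inner:
  "sigma_delta A B x u \<bullet> w + (u $ 0)\<^sup>2 * r1 =
    2 * ((A *v x + B *v u) \<bullet> (S_hat w *v x)) + x \<bullet> (Q_hat w *v x) + u \<bullet> (R_hat w *v u)"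
proof -
  have "u \<bullet> (R_hat w *v u) = (\<Sum>p\<in>UNIV. W_R w $ p * quad_basis u $ p)"
    unfolding R_hat_def inner_quad_basis[symmetric] by (simp add: inner_vec_def)
  also have "\<dots> = r1 * (u $ 0)\<^sup>2 + (\<Sum>q\<in>UNIV. w $ Inr (Inr q) * quad_basis u $ Rep_utri4_tail q)"
    by (simp add: sum_utri_first W_R_utri_first W_R_tail quad_basis_def utri_first_row_col)
  finally have R: "(\<Sum>q\<in>UNIV. quad_basis u $ Rep_utri4_tail q * w $ Inr (Inr q)) =
      u \<bullet> (R_hat w *v u) - (u $ 0)\<^sup>2 * r1"
    by (simp add: mult.commute)
  have "(\<Sum>p\<in>UNIV. (jacobian quad_basis (at x) *v (A *v x + B *v u)) $ p * w $ Inl p) =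
      2 * ((A *v x + B *v u) \<bullet> (S_hat w *v x))"
    unfolding S_hat_def jacobian_quad_basis_inner[symmetric] by (simp add: inner_vec_def W_S_def)
  moreover have "(\<Sum>p\<in>UNIV. quad_basis x $ p * w $ Inr (Inl p)) = x \<bullet> (Q_hat w *v x)"
    unfolding Q_hat_def inner_quad_basis[symmetric] by (simp add: inner_vec_def W_Q_def mult.commute)
  ultimately show ?thesis
    unfolding inner_vec_def[of "sigma_delta A B x u"] sum_widx
    using R by (simp add: sigma_delta_def)
qed

text \<open>By \<open>sigma_R2_smat\<close>, this column is the matrix unit at \<open>(0, 0)\<close>
  applied to \<open>u\<close>. It is the column left out of the regressor.\<close>

lemma sigma_R2_utri_first: "sigma_R2 u $ j $ utri_first = (if j = 0 then u $ 0 else 0)"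
proof -
  have first: "smat (axis utri_first 1) $ i $ j = (if i = 0 \<and> j = 0 then 1 else (0::real))" for i j :: 4
  proof -
    have "Abs_utri (min i j, max i j) = utri_first \<longleftrightarrow> i = 0 \<and> j = 0"
      unfolding utri_first_def
      by (subst Abs_utri_inject) (auto simp: min_def max_def)
    then show ?thesis by (auto simp: smat_def axis_def)
  qed
  have "sigma_R2 u $ j $ utri_first = (sigma_R2 u *v axis utri_first 1) $ j"
    by (simp add: matrix_vector_mult_basis column_def)
  also have "\<dots> = (smat (axis utri_first 1) *v u) $ j"
    by (simp add: sigma_R2_smat)
  also have "\<dots> = (if j = 0 then u $ 0 else 0)"
    by (simp add: matrix_vector_mult_def first if_distrib[of "\<lambda>r. r * _"] sum.delta cong: if_cong)
  finally show ?thesis .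
qed

text \<open>The same bookkeeping as in \<open>sigma_delta_inner\<close>, for the rows expressing
  stationarity in the control.\<close>

lemma sigma_Delta_u_inner:
  "sigma_Delta_u B x u $ j \<bullet> w + (if j = 0 then 2 * u $ 0 * r1 else 0) =
    2 * (transpose B *v (S_hat w *v x) + R_hat w *v u) $ j"
proof -
  have "(R_hat w *v u) $ j = (\<Sum>p\<in>UNIV. sigma_R2 u $ j $ p * W_R w $ p)"
    unfolding R_hat_def sigma_R2_smat[symmetric] by (simp add: matrix_vector_mult_def)
  also have "\<dots> = sigma_R2 u $ j $ utri_first * r1
      + (\<Sum>q\<in>UNIV. sigma_R2 u $ j $ Rep_utri4_tail q * w $ Inr (Inr q))"
    by (simp add: sum_utri_first W_R_utri_first W_R_tail)
  finally have R: "(\<Sum>q\<in>UNIV. 2 * sigma_R2 u $ j $ Rep_utri4_tail q * w $ Inr (Inr q)) =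
      2 * (R_hat w *v u) $ j - 2 * (sigma_R2 u $ j $ utri_first * r1)"
    by (simp add: sum_distrib_left mult.assoc)
  have "(\<Sum>p\<in>UNIV. (transpose B ** transpose (jacobian quad_basis (at x))) $ j $ p * w $ Inl p) =
      ((transpose B ** transpose (jacobian quad_basis (at x))) *v W_S w) $ j"
    by (simp add: matrix_vector_mult_def W_S_def)
  also have "\<dots> = 2 * (transpose B *v (S_hat w *v x)) $ j"
    by (simp add: matrix_vector_mul_assoc[symmetric] transpose_jacobian_quad_basis S_hat_def
        matrix_vector_mult_scaleR del: transpose_matrix_vector)
  finally have S: "(\<Sum>p\<in>UNIV. (transpose B ** transpose (jacobian quad_basis (at x))) $ j $ p * w $ Inl p) =
      2 * (transpose B *v (S_hat w *v x)) $ j" .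
  have "sigma_Delta_u B x u $ j \<bullet> w =
      2 * (transpose B *v (S_hat w *v x)) $ j + (2 * (R_hat w *v u) $ j - 2 * (sigma_R2 u $ j $ utri_first * r1))"
    unfolding inner_vec_def[of "sigma_Delta_u B x u $ j"] sum_widx
    using R S by (simp add: sigma_Delta_u_def)
  then show ?thesis
    by (simp add: sigma_R2_utri_first del: transpose_matrix_vector)
qed

text \<open>
  \<open>riccati_form\<close> is the closed-loop form of the Riccati residual: the two agree when
  \<open>stationarity_form\<close> vanishes.
\<close>

definition riccati_form ::
  "real^'n^'n \<Rightarrow> real^'n^'m \<Rightarrow> real^'n^'n \<Rightarrow> real^'n^'n \<Rightarrow> real^'m^'m \<Rightarrow> real^'n^'n" where
  "riccati_form F K Q S R = transpose F ** S + S ** F + Q + transpose K ** R ** K"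

definition stationarity_form ::
  "real^'m^'n \<Rightarrow> real^'n^'m \<Rightarrow> real^'n^'n \<Rightarrow> real^'m^'m \<Rightarrow> real^'n^'m" where
  "stationarity_form B K S R = transpose B ** S - R ** K"

section \<open>Linearity and symmetry of the two forms\<close>

lemma matrix_add_rdistrib:
  fixes M :: "real^'k^'r"
  shows "(M + N) ** P = M ** P + N ** P"
  by (vector matrix_matrix_mult_def sum.distrib[symmetric] distrib_right)

lemma riccati_form_add:
  "riccati_form F K (Q + Q') (S + S') (R + R') = riccati_form F K Q S R + riccati_form F K Q' S' R'"
  by (simp add: riccati_form_def matrix_add_ldistrib matrix_add_rdistrib)

lemma riccati_form_scaleR:
  "riccati_form F K (c *\<^sub>R Q) (c *\<^sub>R S) (c *\<^sub>R R) = c *\<^sub>R riccati_form F K Q S R"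
  by (simp add: riccati_form_def matrix_scalar_ac scalar_matrix_assoc[symmetric] scaleR_add_right)

lemma stationarity_form_add:
  "stationarity_form B K (S + S') (R + R') = stationarity_form B K S R + stationarity_form B K S' R'"
  by (simp add: stationarity_form_def matrix_add_ldistrib matrix_add_rdistrib)

lemma stationarity_form_scaleR:
  "stationarity_form B K (c *\<^sub>R S) (c *\<^sub>R R) = c *\<^sub>R stationarity_form B K S R"
  by (simp add: stationarity_form_def matrix_scalar_ac scalar_matrix_assoc[symmetric] scaleR_diff_right)

lemma matrix_diff_ldistrib:
  fixes M :: "real^'k^'r"
  shows "M ** (N - P) = M ** N - M ** P"
  by (vector matrix_matrix_mult_def sum_subtractf[symmetric] right_diff_distrib)

lemma matrix_diff_rdistrib:
  fixes M :: "real^'k^'r"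
  shows "(M - N) ** P = M ** P - N ** P"
  by (vector matrix_matrix_mult_def sum_subtractf[symmetric] left_diff_distrib)

lemma transpose_diff:
  fixes M :: "real^'k^'r"
  shows "transpose (M - N) = transpose M - transpose N"
  by (simp add: transpose_def vec_eq_iff)

lemma transpose_add: "transpose (M + N) = transpose M + transpose N"
  by (simp add: transpose_def vec_eq_iff)

text \<open>Values of a quadratic form determine only the symmetric part of its matrix; symmetry
  lets vanishing values force a vanishing matrix.\<close>

lemma symmetric_riccati_form:
  assumes "symmetric_mat Q" "symmetric_mat S" "symmetric_mat R"
  shows "symmetric_mat (riccati_form F K Q S R)"
  using assms by (simp add: symmetric_mat_def riccati_form_def transpose_add matrix_transpose_mul
      transpose_transpose matrix_mul_assoc add.commute)

text \<open>Rows are indexed as in \<open>Sigma_stack\<close>; the factor 2 is that of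
  \<open>sigma_Delta_u_inner\<close>.\<close>

definition stack_form ::
  "('N::finite \<Rightarrow> real^'n) \<Rightarrow> real^'n^'n \<Rightarrow> real^'n^'m \<Rightarrow> real^('N \<times> (unit + 'm::finite))" where
  "stack_form x M D = (\<chi> r. case r of
       (i, Inl _) \<Rightarrow> x i \<bullet> (M *v x i)
     | (i, Inr j) \<Rightarrow> 2 * (D *v x i) $ j)"

lemma stack_form_add: "stack_form x (M + M') (D + D') = stack_form x M D + stack_form x M' D'"
  by (auto simp: stack_form_def vec_eq_iff matrix_vector_mult_add_rdistrib inner_add_right
      split: prod.split sum.split)

lemma stack_form_0: "stack_form x 0 0 = 0"
  by (auto simp: stack_form_def vec_eq_iff split: prod.split sum.split)

text \<open>Substituting the feedback law for the control leaves \<open>Inl\<close> rows quadratic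
  in the state, with the closed-loop matrix \<open>A - B ** K\<close>, and \<open>Inr\<close> rows
  linear in it.\<close>

lemma Sigma_stack_residual:
  fixes ti :: "'N::finite \<Rightarrow> real \<Rightarrow> real option"
  assumes U: "\<And>i. recorded ti U t i = - (K *v recorded ti X t i)"
  shows "Sigma_stack A B ti X U t *v w - Sigma_u_stack ti U t =
    stack_form (recorded ti X t) (riccati_form (A - B ** K) K (Q_hat w) (S_hat w) (R_hat w))
      (stationarity_form B K (S_hat w) (R_hat w))"
proof (rule vec_eq_iff[THEN iffD2], rule allI)
  fix r :: "'N \<times> (unit + 4)"
  obtain i s where r: "r = (i, s)" by (cases r)
  let ?x = "recorded ti X t i" let ?u = "recorded ti U t i"
  let ?S = "S_hat w" let ?R = "R_hat w"
  show "(Sigma_stack A B ti X U t *v w - Sigma_u_stack ti U t) $ r =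
    stack_form (recorded ti X t) (riccati_form (A - B ** K) K (Q_hat w) (S_hat w) (R_hat w))
      (stationarity_form B K (S_hat w) (R_hat w)) $ r"
  proof (cases s)
    case (Inl _)
    have F: "A *v ?x + B *v ?u = (A - B ** K) *v ?x"
      by (simp add: U matrix_vector_mult_diff_rdistrib matrix_vector_mul_assoc vec.neg)
    have sym: "?x \<bullet> (?S *v ((A - B ** K) *v ?x)) = ((A - B ** K) *v ?x) \<bullet> (?S *v ?x)"
      unfolding S_hat_def by (rule inner_symmetric_mult[OF symmetric_smat])
    have "(Sigma_stack A B ti X U t *v w - Sigma_u_stack ti U t) $ r =
        sigma_delta A B ?x ?u \<bullet> w + (?u $ 0)\<^sup>2 * r1"
      by (simp add: r Inl matrix_vector_mul_component Sigma_stack_def Sigma_u_stack_def)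
    also have "\<dots> = 2 * (((A - B ** K) *v ?x) \<bullet> (?S *v ?x)) + ?x \<bullet> (Q_hat w *v ?x) + ?u \<bullet> (?R *v ?u)"
      by (simp only: sigma_delta_inner F)
    also have "?u \<bullet> (?R *v ?u) = ?x \<bullet> (transpose K *v (?R *v (K *v ?x)))"
      by (simp add: U inner_transpose_mult vec.neg del: transpose_matrix_vector)
    also have "2 * (((A - B ** K) *v ?x) \<bullet> (?S *v ?x)) + ?x \<bullet> (Q_hat w *v ?x)
        + ?x \<bullet> (transpose K *v (?R *v (K *v ?x))) =
        ?x \<bullet> (riccati_form (A - B ** K) K (Q_hat w) ?S ?R *v ?x)"
      by (simp add: riccati_form_def matrix_vector_mult_add_rdistrib matrix_vector_mul_assoc[symmetric]
          inner_add_right sym inner_transpose_mult del: transpose_matrix_vector)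
    finally show ?thesis
      by (simp add: r Inl stack_form_def)
  next
    case (Inr j)
    have "(Sigma_stack A B ti X U t *v w - Sigma_u_stack ti U t) $ r =
        sigma_Delta_u B ?x ?u $ j \<bullet> w + (if j = 0 then 2 * ?u $ 0 * r1 else 0)"
      by (simp add: r Inr matrix_vector_mul_component Sigma_stack_def Sigma_u_stack_def)
    also have "\<dots> = 2 * (transpose B *v (?S *v ?x) + ?R *v ?u) $ j"
      by (rule sigma_Delta_u_inner)
    also have "transpose B *v (?S *v ?x) + ?R *v ?u = stationarity_form B K ?S ?R *v ?x"
      by (simp add: stationarity_form_def U vec.neg matrix_vector_mult_diff_rdistrib
          matrix_vector_mul_assoc[symmetric] del: transpose_matrix_vector)
    finally show ?thesis
      by (simp add: r Inr stack_form_def)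
  qed
qed

text \<open>The doubled off-diagonal entries make \<open>dvec M \<bullet> uvec (outer x)\<close> the quadratic form of \<open>M\<close>.\<close>

definition dvec :: "real^('n::{finite,linorder})^('n::{finite,linorder}) \<Rightarrow> real^('n::{finite,linorder} utri)" where
  "dvec M = (\<chi> p. (if urow p = ucol p then 1 else 2) * uvec M $ p)"

lemma dvec_add: "dvec (M + N) = dvec M + dvec N"
  by (simp add: dvec_def uvec_def vec_eq_iff distrib_left)

lemma dvec_scaleR: "dvec (c *\<^sub>R M) = c *\<^sub>R dvec M"
  by (simp add: dvec_def uvec_def vec_eq_iff)

lemma dvec_eq_0:
  assumes "symmetric_mat M" "dvec M = 0"
  shows "M = 0"
proof -
  have "uvec M = 0"
    using assms(2) by (auto simp: dvec_def vec_eq_iff split: if_splits)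
  then have "M = smat 0"
    using smat_uvec[OF assms(1)] by simp
  then show ?thesis
    by (simp add: smat_def vec_eq_iff)
qed

lemma dvec_outer:
  assumes "symmetric_mat M"
  shows "dvec M \<bullet> uvec (outer x) = x \<bullet> (M *v x)"
proof -
  have "dvec M \<bullet> uvec (outer x) = uvec M \<bullet> quad_basis x"
    unfolding inner_vec_def
    by (rule sum.cong) (auto simp: dvec_def uvec_def outer_def quad_basis_def power2_eq_square)
  then show ?thesis
    using smat_uvec[OF assms] by (simp add: inner_quad_basis)
qed

text \<open>Excitation of \<open>Z_data\<close> controls \<open>M\<close>, since
  \<open>dvec M\<close> paired with its columns gives the values of the form; excitation of
  \<open>X_data\<close> controls \<open>D\<close> row by row.\<close>

lemma stack_form_lower_bound:
  fixes D :: "real^12^'m"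
  assumes M: "symmetric_mat M"
    and X: "Min (eig (X_data ti X t ** transpose (X_data ti X t))) > c"
    and Z: "Min (eig (Z_data ti X t ** transpose (Z_data ti X t))) > c"
  shows "c * ((dvec M, D) \<bullet> (dvec M, D)) \<le>
    stack_form (recorded ti X t) M D \<bullet> stack_form (recorded ti X t) M D"
proof -
  let ?x = "recorded ti X t"
  have "c * (dvec M \<bullet> dvec M) \<le> (\<Sum>i\<in>UNIV. (dvec M \<bullet> column i (Z_data ti X t))\<^sup>2)"
    by (rule gram_Min_eig_bound[OF Z])
  also have "\<dots> = (\<Sum>i\<in>UNIV. (?x i \<bullet> (M *v ?x i))\<^sup>2)"
    by (simp add: Z_data_def column_transpose row_def vec_lambda_eta dvec_outer[OF M])
  finally have 1: "c * (dvec M \<bullet> dvec M) \<le> (\<Sum>i\<in>UNIV. (?x i \<bullet> (M *v ?x i))\<^sup>2)" .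
  have "c * (D $ j \<bullet> D $ j) \<le> (\<Sum>i\<in>UNIV. ((D *v ?x i) $ j)\<^sup>2)" for j
    using gram_Min_eig_bound[OF X, of "D $ j"]
    by (simp add: X_data_def column_transpose row_def vec_lambda_eta matrix_vector_mul_component)
  then have "c * (D \<bullet> D) \<le> (\<Sum>j\<in>UNIV. \<Sum>i\<in>UNIV. ((D *v ?x i) $ j)\<^sup>2)"
    unfolding inner_vec_def[of D D] sum_distrib_left by (rule sum_mono)
  also have "\<dots> = (\<Sum>i\<in>UNIV. \<Sum>j\<in>UNIV. ((D *v ?x i) $ j)\<^sup>2)"
    by (rule sum.swap)
  \<comment> \<open>The factor 2 in \<open>stack_form\<close> only enlarges the squares.\<close>
  also have "\<dots> \<le> (\<Sum>i\<in>UNIV. \<Sum>j\<in>UNIV. (2 * (D *v ?x i) $ j)\<^sup>2)"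
    by (intro sum_mono) (simp add: power_mult_distrib)
  finally have 2: "c * (D \<bullet> D) \<le> (\<Sum>i\<in>UNIV. \<Sum>j\<in>UNIV. (2 * (D *v ?x i) $ j)\<^sup>2)" .
  have "stack_form ?x M D \<bullet> stack_form ?x M D =
      (\<Sum>i\<in>UNIV. \<Sum>s\<in>UNIV. (stack_form ?x M D $ (i, s))\<^sup>2)"
    by (simp add: inner_vec_def UNIV_Times_UNIV[symmetric] sum.cartesian_product power2_eq_square
        del: UNIV_Times_UNIV)
  also have "\<dots> = (\<Sum>i\<in>UNIV. (?x i \<bullet> (M *v ?x i))\<^sup>2 + (\<Sum>j\<in>UNIV. (2 * (D *v ?x i) $ j)\<^sup>2))"
    by (simp add: UNIV_Plus_UNIV[symmetric] sum.Plus stack_form_def del: UNIV_Plus_UNIV)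
  finally show ?thesis
    using 1 2 by (simp add: inner_prod_def sum.distrib distrib_left)
qed

text \<open>Stationarity reads \<open>transpose B ** S = R ** K\<close>; cancelling \<open>R\<close>
  gives the feedback. The same substitution in the closed-loop term cancels
  \<open>transpose K ** R ** K\<close>.\<close>

lemma riccati_form_care_residual:
  assumes "invertible R"
    and D: "stationarity_form B K S R = 0" and M: "riccati_form (A - B ** K) K Q S R = 0"
  shows "feedback B S R = K" "care_residual A B Q S R = 0"
proof -
  have BS: "transpose B ** S = R ** K"
    using D by (simp add: stationarity_form_def)
  have "feedback B S R = (matrix_inv R ** R) ** K"
    by (simp add: feedback_def BS matrix_mul_assoc[symmetric])
  then show K: "feedback B S R = K"
    using assms(1) by (simp add: matrix_inv_inverse)
  have c1: "S ** B ** matrix_inv R ** transpose B ** S = S ** B ** K"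
    using K by (simp add: feedback_def matrix_mul_assoc[symmetric])
  have c2: "transpose (A - B ** K) ** S = transpose A ** S - transpose K ** R ** K"
    by (simp add: transpose_diff matrix_transpose_mul matrix_diff_rdistrib BS matrix_mul_assoc[symmetric])
  have c3: "S ** (A - B ** K) = S ** A - S ** B ** K"
    by (simp add: matrix_diff_ldistrib matrix_mul_assoc)
  show "care_residual A B Q S R = 0"
    using M unfolding care_residual_def riccati_form_def c1 c2 c3 by (simp add: algebra_simps)
qed

text \<open>\<open>R_hat\<close> is only affine because its first weight is fixed; subtracting its
  value at 0 leaves the linear part.\<close>

lemma linear_residual:
  defines "R0 \<equiv> R_hat 0"
  shows "linear (\<lambda>v. (dvec (riccati_form F K (Q_hat v) (S_hat v) (R_hat v - R0)),
                   stationarity_form B K (S_hat v) (R_hat v - R0)))"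
proof -
  have Rlin: "R_hat v - R0 = smat (\<chi> p. if p = utri_first then 0 else v $ Inr (Inr (Abs_utri4_tail p)))" for v
    by (auto simp: R0_def R_hat_def W_R_def smat_def vec_eq_iff)
  have R: "R_hat (v + w) - R0 = (R_hat v - R0) + (R_hat w - R0)"
    "R_hat (c *\<^sub>R v) - R0 = c *\<^sub>R (R_hat v - R0)" for v w c
    unfolding Rlin by (auto simp: smat_def vec_eq_iff)
  have S: "S_hat (v + w) = S_hat v + S_hat w" "S_hat (c *\<^sub>R v) = c *\<^sub>R S_hat v" for v w c
    by (auto simp: S_hat_def W_S_def smat_def vec_eq_iff)
  have Q: "Q_hat (v + w) = Q_hat v + Q_hat w" "Q_hat (c *\<^sub>R v) = c *\<^sub>R Q_hat v" for v w c
    by (auto simp: Q_hat_def W_Q_def smat_def vec_eq_iff)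
  show ?thesis
    by (rule linearI) (simp_all only: R S Q riccati_form_add riccati_form_scaleR stationarity_form_add
      stationarity_form_scaleR dvec_add dvec_scaleR add_Pair scaleR_Pair)
qed

section \<open>Convergence to a 0-equivalent solution\<close>

theorem theorem1:
  fixes A :: "real^12^12" and B :: "real^4^12"
    and Q S :: "real^12^12" and R :: "real^4^4"
    and K_EP :: "real^12^4"
    and X :: "real \<Rightarrow> real^12" and U :: "real \<Rightarrow> real^4"
    and \<tau> :: real and ti :: "'N::finite \<Rightarrow> real \<Rightarrow> real option"
    and \<Sigma> :: "real \<Rightarrow> real^widx^('N \<times> (unit + 4))"
    and \<Sigma>\<^sub>u :: "real \<Rightarrow> real^('N \<times> (unit + 4))"
    and \<X> :: "real \<Rightarrow> real^'N^12" and \<Z> :: "real \<Rightarrow> real^'N^(12 utri)"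
    and \<epsilon> \<epsilon>\<^sub>0 T R_bound :: real
    and W :: "real \<Rightarrow> real^widx"
  assumes Q: "pos_semidef Q" and R: "pos_def R"
    and stabilizable: "stabilizable A B"
    and detectable: "detectable A (sqrt_mat Q)"
    and S: "stabilizing_solution A B Q R S"
    and K_EP: "K_EP = feedback B S R"
    and dynamics: "\<And>t. t \<ge> 0 \<Longrightarrow>
          (X has_vector_derivative (A *v X t + B *v U t)) (at t within {0..})"
    and control: "\<And>t. t \<ge> 0 \<Longrightarrow> U t = - (K_EP *v X t)"
    and sampling: "\<tau> > 0" "recording_times \<tau> ti"
    and stack: "\<Sigma> = Sigma_stack A B ti X U" "\<Sigma>\<^sub>u = Sigma_u_stack ti U"
    and data: "\<X> = X_data ti X" "\<Z> = Z_data ti X"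
    and update_law: "update_law_solution \<tau> \<epsilon> \<Sigma> \<Sigma>\<^sub>u W"
    and T: "T \<ge> 0"
    and range: "\<And>t. t \<ge> T \<Longrightarrow> \<Sigma>\<^sub>u t \<in> range (\<lambda>w. \<Sigma> t *v w)"
    and epsilon: "\<epsilon> \<ge> 0" "\<And>t. t \<ge> T \<Longrightarrow> invertible (reg_gram \<epsilon> (\<Sigma> t))"
    and epsilon0: "\<epsilon>\<^sub>0 > 0"
    and excitation: "\<And>t. t \<ge> T \<Longrightarrow> Min (eig (\<X> t ** transpose (\<X> t))) > \<epsilon>\<^sub>0"
      "\<And>t. t \<ge> T \<Longrightarrow> Min (eig (\<Z> t ** transpose (\<Z> t))) > \<epsilon>\<^sub>0"
    and R_bound: "R_bound \<ge> 0" "\<And>t. t \<ge> T \<Longrightarrow> invertible (R_hat (W t))"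
      "\<And>t. t \<ge> T \<Longrightarrow> norm (matrix_inv (R_hat (W t))) \<le> R_bound"
  shows "\<exists>Q' S' R'.
    ((\<lambda>t. Q_hat (W t)) \<longlongrightarrow> Q') at_top \<and>
    ((\<lambda>t. S_hat (W t)) \<longlongrightarrow> S') at_top \<and>
    ((\<lambda>t. R_hat (W t)) \<longlongrightarrow> R') at_top \<and>
    equivalent_solution 0 A B K_EP Q' S' R'"
proof -
  define F where "F = A - B ** K_EP"
  define P where "P w = riccati_form F K_EP (Q_hat w) (S_hat w) (R_hat w)" for w
  define D where "D w = stationarity_form B K_EP (S_hat w) (R_hat w)" for w
  \<comment> \<open>The primed maps are the linear parts of the affine maps \<open>P\<close> and
    \<open>D\<close>. \<open>\<Lambda>\<close> collects them in the coordinates of the excitation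
    bound and does not involve time.\<close>
  define P' where "P' v = riccati_form F K_EP (Q_hat v) (S_hat v) (R_hat v - R_hat 0)" for v
  define D' where "D' v = stationarity_form B K_EP (S_hat v) (R_hat v - R_hat 0)" for v
  define \<Lambda> where "\<Lambda> v = (dvec (P' v), D' v)" for v
  define x where "x t = recorded ti X t" for t
  have lin: "linear \<Lambda>"
    unfolding \<Lambda>_def P'_def D'_def by (rule linear_residual)
  \<comment> \<open>An unfilled slot records zero state and zero control, which also obey the
    feedback law.\<close>
  have rec: "recorded ti U t i = - (K_EP *v recorded ti X t i)" if "t \<ge> T" for t i
  proof (cases "ti i t")
    case (Some s)
    then have "s \<ge> 0"
      using sampling(2) that T unfolding recording_times_def by (meson order_trans)
    then show ?thesis
      using control[of s] Some by (simp add: recorded_def)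
  qed (simp add: recorded_def)
  have residual: "\<Sigma> t *v w - \<Sigma>\<^sub>u t = stack_form (x t) (P w) (D w)" if "t \<ge> T" for t w
    unfolding stack x_def P_def D_def F_def by (rule Sigma_stack_residual[OF rec[OF that]])
  have zero: "S_hat 0 = 0" "Q_hat 0 = 0"
    by (auto simp: S_hat_def W_S_def Q_hat_def W_Q_def smat_def vec_eq_iff)
  have split: "P w = P' w + P 0" "D w = D' w + D 0" for w
    using riccati_form_add[of F K_EP "Q_hat w" 0 "S_hat w" 0 "R_hat w - R_hat 0" "R_hat 0"]
      stationarity_form_add[of B K_EP "S_hat w" 0 "R_hat w - R_hat 0" "R_hat 0"]
    by (simp_all add: P_def P'_def D_def D'_def zero)
  \<comment> \<open>Subtracting the residual at weight 0 removes \<open>\<Sigma>\<^sub>u\<close> and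
    leaves the linear parts.\<close>
  have homogeneous: "\<Sigma> t *v v = stack_form (x t) (P' v) (D' v)" if "t \<ge> T" for t v
  proof -
    have "\<Sigma> t *v v - \<Sigma>\<^sub>u t = stack_form (x t) (P' v) (D' v) + (\<Sigma> t *v 0 - \<Sigma>\<^sub>u t)"
      unfolding residual[OF that] by (metis split stack_form_add)
    then show ?thesis by simp
  qed
  have symR: "symmetric_mat (R_hat v - R_hat 0)" for v
    by (simp add: symmetric_mat_def transpose_diff R_hat_def symmetric_smat[unfolded symmetric_mat_def])
  have symP: "symmetric_mat (P v)" "symmetric_mat (P' v)" for v
    unfolding P_def P'_def
    by (intro symmetric_riccati_form symR; simp add: symmetric_smat S_hat_def Q_hat_def R_hat_def)+
  have lower: "\<epsilon>\<^sub>0 * ((dvec M, N) \<bullet> (dvec M, N)) \<le> stack_form (x t) M N \<bullet> stack_form (x t) M N"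
    if "t \<ge> T" "symmetric_mat M" for t M and N :: "real^12^4"
    unfolding x_def using excitation that unfolding data
    by (intro stack_form_lower_bound) auto
  have kerD: "P' v = 0 \<and> D' v = 0" if "\<Lambda> v = 0" for v
    using that dvec_eq_0[OF symP(2)] by (simp add: \<Lambda>_def zero_prod_def)
  \<comment> \<open>A solution at time \<open>T\<close>. Excitation makes both of its residual forms
    vanish; as these do not involve time, it solves the system at every later time too.\<close>
  obtain w0 where w0: "\<Sigma> T *v w0 = \<Sigma>\<^sub>u T"
    using range[of T] by auto
  have PD0: "P w0 = 0" "D w0 = 0"
  proof -
    have "stack_form (x T) (P w0) (D w0) = 0"
      using residual[of T w0] w0 by simp
    then have "\<epsilon>\<^sub>0 * ((dvec (P w0), D w0) \<bullet> (dvec (P w0), D w0)) \<le> 0"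
      using lower[OF order_refl symP(1), of w0 "D w0"] by simp
    then have "(dvec (P w0), D w0) \<bullet> (dvec (P w0), D w0) \<le> 0"
      using epsilon0 by (simp add: mult_le_0_iff)
    then have "(dvec (P w0), D w0) = 0"
      by (metis inner_eq_zero_iff inner_ge_zero order_antisym)
    then have "dvec (P w0) = 0" "D w0 = 0"
      by (simp_all add: zero_prod_def)
    then show "P w0 = 0" "D w0 = 0"
      using dvec_eq_0[OF symP(1)] by auto
  qed
  obtain w where w: "(W \<longlongrightarrow> w) at_top" "\<Lambda> (w - w0) = 0"
  proof (rule update_law_converges[OF sampling(1) T epsilon(1) epsilon0 update_law epsilon(2) lin])
    fix t v assume t: "t \<ge> T"
    show "\<epsilon>\<^sub>0 * (\<Lambda> v \<bullet> \<Lambda> v) \<le> (\<Sigma> t *v v) \<bullet> (\<Sigma> t *v v)"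
      unfolding homogeneous[OF t] \<Lambda>_def by (rule lower[OF t symP(2)])
    show "\<Sigma> t *v v = 0" if "\<Lambda> v = 0"
      using kerD[OF that] by (simp add: homogeneous[OF t] stack_form_0)
    show "\<Sigma> t *v w0 = \<Sigma>\<^sub>u t"
      using residual[OF t, of w0] PD0 by (simp add: stack_form_0)
  qed auto
  have PD: "P w = 0" "D w = 0"
  proof -
    \<comment> \<open>The limit may differ from \<open>w0\<close> by a kernel vector of
      \<open>\<Lambda>\<close>, which leaves both residual forms unchanged.\<close>
    have "\<Lambda> w = \<Lambda> w0"
      using w(2) by (simp add: linear_diff[OF lin])
    then have "dvec (P' w) = dvec (P' w0)" "D' w = D' w0"
      by (simp_all add: \<Lambda>_def)
    then have "dvec (P w) = dvec (P w0)" "D w = D w0"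
      by (simp_all add: split[of w] split[of w0] dvec_add)
    then show "P w = 0" "D w = 0"
      using PD0 dvec_eq_0[OF symP(1), of w] by (auto simp: dvec_def uvec_def vec_eq_iff)
  qed
  have conv: "((\<lambda>t. Q_hat (W t)) \<longlongrightarrow> Q_hat w) at_top" "((\<lambda>t. S_hat (W t)) \<longlongrightarrow> S_hat w) at_top"
    "((\<lambda>t. R_hat (W t)) \<longlongrightarrow> R_hat w) at_top"
    unfolding Q_hat_def S_hat_def R_hat_def W_Q_def W_S_def W_R_def smat_def if_distrib
    by (auto intro!: tendsto_vec_lambda tendsto_vec_nth[OF w(1)])
  have "invertible (R_hat w)"
    by (rule invertible_limit[OF conv(3), of R_bound])
      (auto simp: eventually_at_top_linorder R_bound intro!: exI[of _ T])
  moreover from riccati_form_care_residual[OF this PD(2)[unfolded D_def] PD(1)[unfolded P_def F_def]]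
  have "feedback B (S_hat w) (R_hat w) = K_EP" "care_residual A B (Q_hat w) (S_hat w) (R_hat w) = 0" .
  ultimately have "equivalent_solution 0 A B K_EP (Q_hat w) (S_hat w) (R_hat w)"
    by (simp add: equivalent_solution_def Q_hat_def S_hat_def R_hat_def symmetric_smat)
  then show ?thesis
    using conv by blast
qed

end
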